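(* Let $f:\mathbb{R}^n\to\mathbb{R}$ be $\mathbf M$-smooth, $\mathbf M\succ0$, and $\mu$-strongly convex, $\mu>0$, with minimizer $x^*$. Let $S$ be a proper sampling with probability vector $p$ and probability matrix $\mathbf P$, and let $v\in\mathbb{R}^n$ satisfy the ESO inequality $\mathbf P\circ\mathbf M\preceq\mathrm{Diag}(p)\,\mathrm{Diag}(v)$. Write $\hat{\mathbf P}=\mathrm{Diag}(p)$, $\hat{\mathbf V}=\mathrm{Diag}(v)$. Choose $\alpha,\sigma>0$ such that $$\sigma\mathbf I-\alpha^2\left(\hat{\mathbf V}\hat{\mathbf P}^{-1}-\mathbf M\right)\succeq\gamma\mu\sigma\hat{\mathbf P}^{-1},\qquad\text{where}\quad \gamma=\alpha-\alpha^2\max_i\left\{\frac{v_i}{p_i}\right\}-\sigma.$$ Let $\Psi^k=f(x^k)-f(x^* )+\sigma\|h^k\|_{\hat{\mathbf P}^{-1}}^2$. Then the iterates of SEGA with coordinate sketches satisfy $$\mathbb{E}[\Psi^k]\le(1-\gamma\mu)^k\,\Psi^0 .$$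
   Context: $\nabla f$ is the usual gradient; $\|x\|_{\mathbf W}^2=x^\top\mathbf Wx$; $\circ$ is the entrywise (Hadamard) product; $\preceq$ is the Loewner order; $\mathbf I$ is the identity matrix. $f$ is $\mathbf M$-smooth if it is differentiable and $f(x)\le f(y)+\langle\nabla f(y),x-y\rangle+\frac12\|x-y\|_{\mathbf M}^2$ for all $x,y$; $\mu$-strongly convex if $f(x)\ge f(y)+\langle\nabla f(y),x-y\rangle+\frac\mu2\|x-y\|_2^2$ for all $x,y$. A sampling $S$ is a random subset of $\{1,\dots,n\}$. Its probability vector is $p_i=\mathrm{Prob}(i\in S)$ and its probability matrix is $\mathbf P_{ij}=\mathrm{Prob}(\{i,j\}\subseteq S)$; $S$ is proper if $p_i>0$ for all $i$. $\mathbf I_S$ is the column submatrix of the identity with columns $e_i$, $i\in S$. SEGA with coordinate sketches (no regularizer), started from $x^0,h^0\in\mathbb{R}^n$ with stepsize $\alpha$: for $k=0,1,2,\dots$ draw $S_k$, an independent copy of $S$, and set $g^k=h^k+\hat{\mathbf P}^{-1}\mathbf I_{S_k}\mathbf I_{S_k}^\top(\nabla f(x^k)-h^k)$, $\;x^{k+1}=x^k-\alpha g^k$, $\;h^{k+1}=h^k+\mathbf I_{S_k}\mathbf I_{S_k}^\top(\nabla f(x^k)-h^k)$.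
   Formalization: The formal statement additionally assumes γ ≥ 0; without it the claim fails, e.g. n=1, S={1} always, f(x)=x²/2, M=v=μ=α=1, σ=2 (so γ=−2), x⁰=1, h⁰=0 gives Ψ¹=2 > 3/2. *)

theory Defs
  imports "HOL-Probability.Probability"
begin

section \<open>Matrices\<close>

definition diag_mat :: "real ^ 'n \<Rightarrow> real ^ 'n ^ 'n" where
  "diag_mat v = (\<chi> i j. if i = j then v $ i else 0)"

definition hadamard :: "real ^ 'n ^ 'n \<Rightarrow> real ^ 'n ^ 'n \<Rightarrow> real ^ 'n ^ 'n" where
  "hadamard A B = (\<chi> i j. A $ i $ j * B $ i $ j)"

definition wnorm2 :: "real ^ 'n ^ 'n \<Rightarrow> real ^ 'n \<Rightarrow> real" where
  "wnorm2 W x = x \<bullet> (W *v x)"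

definition pos_def :: "real ^ 'n ^ 'n \<Rightarrow> bool" where
  "pos_def A \<longleftrightarrow> transpose A = A \<and> (\<forall>x. x \<noteq> 0 \<longrightarrow> 0 < x \<bullet> (A *v x))"

definition pos_semidef :: "real ^ 'n ^ 'n \<Rightarrow> bool" where
  "pos_semidef A \<longleftrightarrow> transpose A = A \<and> (\<forall>x. 0 \<le> x \<bullet> (A *v x))"

definition loewner_le :: "real ^ 'n ^ 'n \<Rightarrow> real ^ 'n ^ 'n \<Rightarrow> bool" where
  "loewner_le A B \<longleftrightarrow> pos_semidef (B - A)"


section \<open>Gradients, smoothness, strong convexity\<close>

text \<open>Meaningful only where \<open>f\<close> is differentiable; \<open>GDERIV\<close> then determines the
  gradient uniquely.\<close>

definition grad :: "(real ^ 'n \<Rightarrow> real) \<Rightarrow> real ^ 'n \<Rightarrow> real ^ 'n" where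
  "grad f x = (THE D. GDERIV f x :> D)"

definition mat_smooth :: "real ^ 'n ^ 'n \<Rightarrow> (real ^ 'n \<Rightarrow> real) \<Rightarrow> bool" where
  "mat_smooth M f \<longleftrightarrow>
     (\<forall>x. f differentiable (at x)) \<and>
     (\<forall>x y. f x \<le> f y + grad f y \<bullet> (x - y) + 1/2 * wnorm2 M (x - y))"

text \<open>Differentiability is not part of this definition: it is to be used together with
  \<^const>\<open>mat_smooth\<close>.\<close>

definition strongly_convex :: "real \<Rightarrow> (real ^ 'n \<Rightarrow> real) \<Rightarrow> bool" where
  "strongly_convex \<mu> f \<longleftrightarrow>
     (\<forall>x y. f x \<ge> f y + grad f y \<bullet> (x - y) + \<mu>/2 * (norm (x - y))\<^sup>2)"


section \<open>Samplings\<close>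

text \<open>The index set \<open>{1,\<dots>,n}\<close> is the finite type \<open>'n\<close>. A sampling is given by its law, a
  probability mass function on the subsets of \<open>'n\<close>.\<close>

definition prob_vec :: "'n::finite set pmf \<Rightarrow> real ^ 'n" where
  "prob_vec D = (\<chi> i. measure_pmf.prob D {A. i \<in> A})"

definition prob_mat :: "'n::finite set pmf \<Rightarrow> real ^ 'n ^ 'n" where
  "prob_mat D = (\<chi> i j. measure_pmf.prob D {A. {i, j} \<subseteq> A})"

definition proper_sampling :: "'n::finite set pmf \<Rightarrow> bool" where
  "proper_sampling D \<longleftrightarrow> (\<forall>i. 0 < prob_vec D $ i)"

text \<open>The product \<open>I\<^sub>A I\<^sub>A\<^sup>T\<close>, where the \<open>n \<times> |A|\<close> matrix \<open>I\<^sub>A\<close> consists of the columns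
  \<open>l \<in> A\<close> of the identity. As \<open>|A|\<close> is random, \<open>I\<^sub>A\<close> itself has no fixed type; its column
  index \<open>l\<close> is the summation index below.\<close>

definition sketch_mat :: "'n::finite set \<Rightarrow> real ^ 'n ^ 'n" where
  "sketch_mat A = (\<chi> i j. \<Sum>l\<in>A. (mat 1 :: real ^ 'n ^ 'n) $ i $ l * (mat 1 :: real ^ 'n ^ 'n) $ j $ l)"


section \<open>SEGA with coordinate sketches\<close>

text \<open>\<open>sega f D \<alpha> x0 h0 S k\<close> is the pair \<open>(x\<^sup>k, h\<^sup>k)\<close> obtained from the realized draws
  \<open>S 0, S 1, \<dots>\<close>; only \<open>S 0, \<dots>, S (k - 1)\<close> enter. The law \<open>D\<close> enters through the matrix
  \<open>Diag(p)\<close> only.\<close>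

definition sega_g ::
    "(real ^ 'n \<Rightarrow> real) \<Rightarrow> 'n::finite set pmf \<Rightarrow> 'n set \<Rightarrow> real ^ 'n \<Rightarrow> real ^ 'n \<Rightarrow> real ^ 'n" where
  "sega_g f D A x h =
     h + matrix_inv (diag_mat (prob_vec D)) *v (sketch_mat A *v (grad f x - h))"

primrec sega ::
    "(real ^ 'n \<Rightarrow> real) \<Rightarrow> 'n::finite set pmf \<Rightarrow> real \<Rightarrow> real ^ 'n \<Rightarrow> real ^ 'n \<Rightarrow>
     (nat \<Rightarrow> 'n set) \<Rightarrow> nat \<Rightarrow> (real ^ 'n) \<times> (real ^ 'n)" where
  "sega f D \<alpha> x0 h0 S 0 = (x0, h0)"
| "sega f D \<alpha> x0 h0 S (Suc k) =
     (let (x, h) = sega f D \<alpha> x0 h0 S k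
      in (x - \<alpha> *\<^sub>R sega_g f D (S k) x h, h + sketch_mat (S k) *v (grad f x - h)))"

definition lyapunov ::
    "(real ^ 'n \<Rightarrow> real) \<Rightarrow> real ^ 'n \<Rightarrow> 'n::finite set pmf \<Rightarrow> real \<Rightarrow>
     (real ^ 'n) \<times> (real ^ 'n) \<Rightarrow> real" where
  "lyapunov f xstar D \<sigma> = (\<lambda>(x, h).
     f x - f xstar + \<sigma> * wnorm2 (matrix_inv (diag_mat (prob_vec D))) h)"

end

theory Submission
  imports Defs
begin

text \<open>
  The proof has a deterministic half and a probabilistic half.

  One step. Fix a state \<open>(x, h)\<close>, put \<open>u = grad f x\<close> and let the only randomness be the draw
  \<open>A\<close>. Smoothness bounds \<open>f\<close> at the new point by
  \<open>f x - \<alpha> \<langle>u, g\<rangle> + \<alpha>\<^sup>2/2 \<parallel>g\<parallel>\<^sup>2\<^sub>M\<close>. The estimator \<open>g\<close> is unbiased, so the linear term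
  contributes \<open>-\<alpha> \<parallel>u\<parallel>\<^sup>2\<close>. For the quadratic term, write \<open>T z = P\<^sup>-\<^sup>1 I\<^sub>A I\<^sub>A\<^sup>T z\<close>, so that
  \<open>g = T u + (h - T h)\<close> and \<open>\<parallel>g\<parallel>\<^sup>2 \<le> 2 \<parallel>T u\<parallel>\<^sup>2 + 2 \<parallel>h - T h\<parallel>\<^sup>2\<close>. The ESO inequality bounds
  the mean of \<open>\<parallel>T z\<parallel>\<^sup>2\<close> by \<open>\<Sum>i. v\<^sub>i/p\<^sub>i z\<^sub>i\<^sup>2\<close>, and since \<open>T h\<close> has mean \<open>h\<close>, the second part is a
  variance, which is what produces \<open>V P\<^sup>-\<^sup>1 - M\<close>
  (lemma \<open>expectation_wnorm2_sega_g\<close>). Refreshing the coordinates in \<open>A\<close> changes the mean of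
  \<open>\<parallel>h\<parallel>\<^sup>2\<close> in the \<open>P\<^sup>-\<^sup>1\<close>-norm by exactly \<open>\<parallel>u\<parallel>\<^sup>2 - \<parallel>h\<parallel>\<^sup>2\<close>: the weights \<open>1/p\<^sub>i\<close> cancel the
  probabilities. Summing up, the coefficient of \<open>\<parallel>u\<parallel>\<^sup>2\<close> is at most \<open>-\<gamma>\<close>, and the form in \<open>h\<close> is
  the one controlled by the stepsize condition. Strong convexity gives
  \<open>\<parallel>u\<parallel>\<^sup>2 \<ge> 2 \<mu> (f x - f xstar)\<close>, hence contraction by \<open>1 - \<gamma> \<mu>\<close>
  (lemma \<open>sega_lyapunov_contraction\<close>).

  All steps. The \<open>k\<close>-th iterate is a function of the first \<open>k\<close> draws, hence independent of
  the next one, and it takes finitely many values. Averaging over the next draw first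
  (lemma \<open>expectation_indep_pmf\<close>) turns the one-step estimate into
  \<open>E \<Psi>\<^sup>k\<^sup>+\<^sup>1 \<le> (1 - \<gamma> \<mu>) E \<Psi>\<^sup>k\<close>. Iterating this needs \<open>1 - \<gamma> \<mu> \<ge> 0\<close>, which the one-step
  estimate itself supplies: its left side is nonnegative, and \<open>\<Psi>\<close> is positive somewhere.
\<close>

section \<open>Diagonal matrices, sketches and quadratic forms\<close>

lemma diag_mat_mult_vec: "(diag_mat d *v z) $ i = d $ i * z $ i"
  by (simp add: diag_mat_def matrix_vector_mult_def if_distrib[of "\<lambda>a. a * _"] cong: if_cong)

lemma diag_mat_mult_diag_mat: "diag_mat a ** diag_mat b = diag_mat (\<chi> i. a $ i * b $ i)"
  by (simp add: matrix_eq vec_eq_iff diag_mat_mult_vec flip: matrix_vector_mul_assoc)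

lemma matrix_inv_diag_mat:
  assumes "\<And>i. d $ i \<noteq> 0"
  shows "matrix_inv (diag_mat d) = diag_mat (\<chi> i. 1 / d $ i)"
proof -
  let ?B = "diag_mat (\<chi> i. 1 / d $ i)"
  have inverse: "diag_mat d ** ?B = mat 1 \<and> ?B ** diag_mat d = mat 1"
    using assms unfolding diag_mat_mult_diag_mat
    by (simp_all add: diag_mat_def mat_def vec_eq_iff)
  then have "diag_mat d ** matrix_inv (diag_mat d) = mat 1 \<and>
      matrix_inv (diag_mat d) ** diag_mat d = mat 1"
    unfolding matrix_inv_def by (rule someI)
  with inverse show ?thesis
    by (metis matrix_mul_assoc matrix_mul_lid matrix_mul_rid)
qed

lemma sketch_mat_mult_vec: "(sketch_mat A *v z) $ i = (if i \<in> A then z $ i else 0)"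
proof -
  have fin: "finite A"
    by simp
  have "sketch_mat A $ i $ j = (if j = i then (if i \<in> A then 1 else 0) else 0)" for j
    by (auto simp: sketch_mat_def mat_def fin sum.delta' if_distrib[of "\<lambda>a. _ * a"] cong: if_cong)
  then have "(sketch_mat A *v z) $ i =
      (\<Sum>j\<in>UNIV. if j = i then (if i \<in> A then 1 else 0) * z $ j else 0)"
    unfolding matrix_vector_mult_def vec_lambda_beta by (intro sum.cong) auto
  then show ?thesis
    by simp
qed

lemma wnorm2_eq_sum: "wnorm2 W z = (\<Sum>i\<in>UNIV. \<Sum>j\<in>UNIV. W $ i $ j * (z $ i * z $ j))"
  by (simp add: wnorm2_def inner_vec_def matrix_vector_mult_def sum_distrib_left algebra_simps)

lemma wnorm2_diag_mat: "wnorm2 (diag_mat d) z = (\<Sum>i\<in>UNIV. d $ i * (z $ i)\<^sup>2)"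
  by (simp add: wnorm2_def inner_vec_def diag_mat_mult_vec power2_eq_square algebra_simps)

lemma wnorm2_scaleR_vec: "wnorm2 W (c *\<^sub>R z) = c\<^sup>2 * wnorm2 W z"
  by (simp add: wnorm2_def matrix_vector_mult_scaleR power2_eq_square)

lemma wnorm2_nonneg: "pos_def W \<Longrightarrow> 0 \<le> wnorm2 W z"
  by (cases "z = 0") (auto simp: pos_def_def wnorm2_def less_imp_le)

lemma loewner_leD: "loewner_le A B \<Longrightarrow> wnorm2 A z \<le> wnorm2 B z"
  by (auto simp: loewner_le_def pos_semidef_def wnorm2_def matrix_vector_mult_diff_rdistrib
      inner_diff_right)

text \<open>The parallelogram law, with \<open>\<parallel>a - b\<parallel>\<^sup>2\<^sub>W \<ge> 0\<close> dropped.\<close>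

lemma wnorm2_add_le:
  assumes "pos_def W"
  shows "wnorm2 W (a + b) \<le> 2 * wnorm2 W a + 2 * wnorm2 W b"
  using wnorm2_nonneg[OF assms, of "a - b"]
  by (simp add: wnorm2_def matrix_vector_right_distrib matrix_vector_mult_diff_distrib
      inner_add_left inner_add_right inner_diff_left inner_diff_right)

section \<open>Expectations over one draw\<close>

text \<open>A sampling has finite support, so every function of the draw has a mean, and
  \<open>integral\<close> rules apply to it without side conditions.\<close>

lemma integrable_sampling [simp]: "integrable (measure_pmf D) (g :: 'n::finite set \<Rightarrow> real)"
  by (simp add: integrable_measure_pmf_finite)

abbreviation unbiased_sketch :: "'n::finite set pmf \<Rightarrow> 'n set \<Rightarrow> real ^ 'n \<Rightarrow> real ^ 'n" where
  "unbiased_sketch D A z \<equiv> matrix_inv (diag_mat (prob_vec D)) *v (sketch_mat A *v z)"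

lemma matrix_inv_prob_vec:
  "proper_sampling D \<Longrightarrow> matrix_inv (diag_mat (prob_vec D)) = diag_mat (\<chi> i. 1 / prob_vec D $ i)"
  by (intro matrix_inv_diag_mat) (simp add: proper_sampling_def less_imp_neq[symmetric])

lemma unbiased_sketch_nth:
  "proper_sampling D \<Longrightarrow>
     unbiased_sketch D A z $ i = (if i \<in> A then z $ i / prob_vec D $ i else 0)"
  by (simp add: matrix_inv_prob_vec diag_mat_mult_vec sketch_mat_mult_vec)

lemma expectation_if_mem:
  "measure_pmf.expectation D (\<lambda>A. if i \<in> A then a else b) =
     prob_vec D $ i * a + (1 - prob_vec D $ i) * (b::real)"
proof -
  have "measure_pmf.expectation D (\<lambda>A. if i \<in> A then a else b) =
      measure_pmf.expectation D (\<lambda>A. b + indicator {A. i \<in> A} A * (a - b))"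
    by (intro Bochner_Integration.integral_cong) auto
  also have "\<dots> = b + prob_vec D $ i * (a - b)"
    by (simp add: prob_vec_def)
  finally show ?thesis
    by (simp add: algebra_simps)
qed

lemma expectation_if_pair:
  "measure_pmf.expectation D (\<lambda>A. if i \<in> A \<and> j \<in> A then a else 0) = prob_mat D $ i $ j * (a::real)"
proof -
  have "measure_pmf.expectation D (\<lambda>A. if i \<in> A \<and> j \<in> A then a else 0) =
      measure_pmf.expectation D (\<lambda>A. indicator {A. {i, j} \<subseteq> A} A * a)"
    by (intro Bochner_Integration.integral_cong) auto
  then show ?thesis
    by (simp add: prob_mat_def)
qed

lemma expectation_inner_unbiased_sketch:
  assumes "proper_sampling D"
  shows "measure_pmf.expectation D (\<lambda>A. c \<bullet> unbiased_sketch D A z) = c \<bullet> z"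
proof -
  have p: "prob_vec D $ i \<noteq> 0" for i
    using assms by (simp add: proper_sampling_def less_imp_neq[symmetric])
  have "measure_pmf.expectation D (\<lambda>A. c \<bullet> unbiased_sketch D A z) =
      (\<Sum>i\<in>UNIV. c $ i * measure_pmf.expectation D
         (\<lambda>A. if i \<in> A then z $ i / prob_vec D $ i else 0))"
    by (simp add: inner_vec_def unbiased_sketch_nth[OF assms])
  also have "\<dots> = c \<bullet> z"
    using p by (simp add: expectation_if_mem inner_vec_def)
  finally show ?thesis .
qed

text \<open>The restriction of \<open>M\<close> to random rows and columns \<open>A\<close> has mean \<open>P \<circ> M\<close>; this is why the
  ESO inequality is stated for the Hadamard product.\<close>

lemma expectation_wnorm2_unbiased_sketch_le:
  assumes proper: "proper_sampling D"
    and ESO: "loewner_le (hadamard (prob_mat D) M) (diag_mat (prob_vec D) ** diag_mat v)"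
  shows "measure_pmf.expectation D (\<lambda>A. wnorm2 M (unbiased_sketch D A z))
     \<le> (\<Sum>i\<in>UNIV. v $ i / prob_vec D $ i * (z $ i)\<^sup>2)"
proof -
  define y where "y = (\<chi> i. z $ i / prob_vec D $ i)"
  have p: "prob_vec D $ i \<noteq> 0" for i
    using proper by (simp add: proper_sampling_def less_imp_neq[symmetric])
  have "measure_pmf.expectation D (\<lambda>A. wnorm2 M (unbiased_sketch D A z)) =
      measure_pmf.expectation D (\<lambda>A. \<Sum>i\<in>UNIV. \<Sum>j\<in>UNIV.
        M $ i $ j * (if i \<in> A \<and> j \<in> A then y $ i * y $ j else 0))"
    unfolding wnorm2_eq_sum
    by (intro Bochner_Integration.integral_cong sum.cong)
      (auto simp: unbiased_sketch_nth[OF proper] y_def)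
  also have "\<dots> = wnorm2 (hadamard (prob_mat D) M) y"
    by (simp add: expectation_if_pair wnorm2_eq_sum hadamard_def mult_ac)
  also have "\<dots> \<le> wnorm2 (diag_mat (prob_vec D) ** diag_mat v) y"
    by (rule loewner_leD[OF ESO])
  also have "\<dots> = (\<Sum>i\<in>UNIV. v $ i / prob_vec D $ i * (z $ i)\<^sup>2)"
    using p by (simp add: diag_mat_mult_diag_mat wnorm2_diag_mat y_def field_simps power2_eq_square)
  finally show ?thesis .
qed

text \<open>Because \<open>unbiased_sketch\<close> has mean \<open>h\<close>, this is a variance: second moment minus
  \<open>\<parallel>h\<parallel>\<^sup>2\<^sub>M\<close>.\<close>

lemma expectation_wnorm2_sketch_error:
  assumes proper: "proper_sampling D"
  shows "measure_pmf.expectation D (\<lambda>A. wnorm2 M (h - unbiased_sketch D A h)) =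
     measure_pmf.expectation D (\<lambda>A. wnorm2 M (unbiased_sketch D A h)) - wnorm2 M h"
proof -
  let ?T = "\<lambda>A. unbiased_sketch D A h"
  have "wnorm2 M (h - t) = wnorm2 M h - (h v* M) \<bullet> t - (M *v h) \<bullet> t + wnorm2 M t" for t
    by (simp add: wnorm2_def matrix_vector_mult_diff_distrib inner_diff_left inner_diff_right
        dot_lmul_matrix inner_commute[of t] del: transpose_matrix_vector)
  moreover have "(h v* M) \<bullet> h = wnorm2 M h" "(M *v h) \<bullet> h = wnorm2 M h"
    by (simp_all add: wnorm2_def inner_commute[of "M *v h"] dot_lmul_matrix)
  ultimately show ?thesis
    by (simp add: expectation_inner_unbiased_sketch[OF proper])
qed

lemma expectation_inner_sega_g:
  assumes "proper_sampling D"
  shows "measure_pmf.expectation D (\<lambda>A. c \<bullet> sega_g f D A x h) = c \<bullet> grad f x"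
  by (simp add: sega_g_def inner_add_right expectation_inner_unbiased_sketch[OF assms]
      inner_diff_right)

lemma expectation_wnorm2_sega_g:
  fixes f :: "real ^ 'n \<Rightarrow> real"
  assumes M: "pos_def M"
    and proper: "proper_sampling D"
    and ESO: "loewner_le (hadamard (prob_mat D) M) (diag_mat (prob_vec D) ** diag_mat v)"
  shows "measure_pmf.expectation D (\<lambda>A. wnorm2 M (sega_g f D A x h))
     \<le> 2 * (\<Sum>i\<in>UNIV. v $ i / prob_vec D $ i * (grad f x $ i)\<^sup>2) +
       2 * ((\<Sum>i\<in>UNIV. v $ i / prob_vec D $ i * (h $ i)\<^sup>2) - wnorm2 M h)"
proof -
  let ?E = "measure_pmf.expectation D" and ?T = "unbiased_sketch D"
  have split: "sega_g f D A x h = ?T A (grad f x) + (h - ?T A h)" for A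
    by (simp add: sega_g_def matrix_vector_mult_diff_distrib)
  have "?E (\<lambda>A. wnorm2 M (sega_g f D A x h))
      \<le> ?E (\<lambda>A. 2 * wnorm2 M (?T A (grad f x)) + 2 * wnorm2 M (h - ?T A h))"
    by (intro integral_mono) (simp_all add: split wnorm2_add_le[OF M])
  also have "\<dots> = 2 * ?E (\<lambda>A. wnorm2 M (?T A (grad f x))) +
      2 * (?E (\<lambda>A. wnorm2 M (?T A h)) - wnorm2 M h)"
    by (simp add: expectation_wnorm2_sketch_error[OF proper])
  also have "\<dots> \<le> 2 * (\<Sum>i\<in>UNIV. v $ i / prob_vec D $ i * (grad f x $ i)\<^sup>2) +
       2 * ((\<Sum>i\<in>UNIV. v $ i / prob_vec D $ i * (h $ i)\<^sup>2) - wnorm2 M h)"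
    by (intro add_mono mult_left_mono diff_right_mono
        expectation_wnorm2_unbiased_sketch_le[OF proper ESO]) simp_all
  finally show ?thesis .
qed

lemma expectation_wnorm2_control_vector:
  assumes proper: "proper_sampling D"
  shows "measure_pmf.expectation D (\<lambda>A.
       wnorm2 (matrix_inv (diag_mat (prob_vec D))) (h + sketch_mat A *v (u - h)))
     = wnorm2 (matrix_inv (diag_mat (prob_vec D))) h + u \<bullet> u - h \<bullet> h"
proof -
  let ?E = "measure_pmf.expectation D" and ?p = "prob_vec D"
  have p: "?p $ i \<noteq> 0" for i
    using proper by (simp add: proper_sampling_def less_imp_neq[symmetric])
  have "?E (\<lambda>A. wnorm2 (matrix_inv (diag_mat ?p)) (h + sketch_mat A *v (u - h))) =
      ?E (\<lambda>A. \<Sum>i\<in>UNIV. 1 / ?p $ i * (if i \<in> A then (u $ i)\<^sup>2 else (h $ i)\<^sup>2))"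
    by (intro Bochner_Integration.integral_cong refl)
      (auto simp: matrix_inv_prob_vec[OF proper] wnorm2_diag_mat sketch_mat_mult_vec
        intro!: sum.cong)
  also have "\<dots> = (\<Sum>i\<in>UNIV. 1 / ?p $ i * ?E (\<lambda>A. if i \<in> A then (u $ i)\<^sup>2 else (h $ i)\<^sup>2))"
    by simp
  also have "\<dots> = (\<Sum>i\<in>UNIV. 1 / ?p $ i * (h $ i)\<^sup>2 + (u $ i)\<^sup>2 - (h $ i)\<^sup>2)"
    unfolding expectation_if_mem using p by (intro sum.cong refl) (simp add: field_simps)
  also have "\<dots> = wnorm2 (matrix_inv (diag_mat ?p)) h + u \<bullet> u - h \<bullet> h"
    by (simp add: matrix_inv_prob_vec[OF proper] wnorm2_diag_mat inner_vec_def
        sum.distrib sum_subtractf power2_eq_square)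
  finally show ?thesis .
qed

section \<open>Contraction of the Lyapunov function in one step\<close>

text \<open>The Polyak--Lojasiewicz inequality: minimizing the quadratic lower bound of strong
  convexity over the displacement costs at most \<open>\<parallel>grad f x\<parallel>\<^sup>2 / (2 \<mu>)\<close>.\<close>

lemma strongly_convex_gradient_dominated:
  assumes "strongly_convex \<mu> f" "\<mu> > 0"
  shows "2 * \<mu> * (f x - f y) \<le> grad f x \<bullet> grad f x"
proof -
  let ?u = "grad f x" and ?d = "y - x"
  have "f x + ?u \<bullet> ?d + \<mu>/2 * (?d \<bullet> ?d) \<le> f y"
    using assms(1) by (simp add: strongly_convex_def power2_norm_eq_inner)
  then have "2 * \<mu> * (f x + ?u \<bullet> ?d + \<mu>/2 * (?d \<bullet> ?d)) \<le> 2 * \<mu> * f y"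
    using \<open>\<mu> > 0\<close> by simp
  moreover have "0 \<le> (?u + \<mu> *\<^sub>R ?d) \<bullet> (?u + \<mu> *\<^sub>R ?d)"
    by simp
  then have "0 \<le> ?u \<bullet> ?u + 2 * \<mu> * (?u \<bullet> ?d) + \<mu> * \<mu> * (?d \<bullet> ?d)"
    by (simp only: inner_add_left inner_add_right inner_scaleR_left inner_scaleR_right)
      (simp add: inner_commute algebra_simps)
  ultimately show ?thesis
    by (simp add: algebra_simps)
qed

definition sega_step ::
    "(real ^ 'n \<Rightarrow> real) \<Rightarrow> 'n::finite set pmf \<Rightarrow> real \<Rightarrow> (real ^ 'n) \<times> (real ^ 'n) \<Rightarrow> 'n set \<Rightarrow>
     (real ^ 'n) \<times> (real ^ 'n)" where
  "sega_step f D \<alpha> = (\<lambda>(x, h) A.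
     (x - \<alpha> *\<^sub>R sega_g f D A x h, h + sketch_mat A *v (grad f x - h)))"

lemma sega_Suc: "sega f D \<alpha> x0 h0 S (Suc k) = sega_step f D \<alpha> (sega f D \<alpha> x0 h0 S k) (S k)"
  by (simp add: sega_step_def Let_def split: prod.split)

lemma lyapunov_nonneg:
  assumes "proper_sampling D" "0 \<le> \<sigma>" "\<forall>x. f xstar \<le> f x"
  shows "0 \<le> lyapunov f xstar D \<sigma> s"
proof -
  have "0 \<le> wnorm2 (matrix_inv (diag_mat (prob_vec D))) h" for h
    using assms(1) by (auto simp: matrix_inv_prob_vec wnorm2_diag_mat proper_sampling_def
        intro!: sum_nonneg divide_nonneg_pos)
  then show ?thesis
    using assms by (auto simp: lyapunov_def split: prod.split)
qed

text \<open>The stepsize condition, read as an inequality of quadratic forms in \<open>h\<close>, is precisely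
  what absorbs the variance term \<open>\<alpha>\<^sup>2 (\<Sum>i. v\<^sub>i/p\<^sub>i h\<^sub>i\<^sup>2 - \<parallel>h\<parallel>\<^sup>2\<^sub>M)\<close> left over from \<open>f\<close> into the
  decrease \<open>\<sigma> \<parallel>h\<parallel>\<^sup>2\<close> of the control vector, leaving a \<open>\<gamma> \<mu>\<close> fraction of the second part of the
  Lyapunov function.\<close>

lemma sega_lyapunov_contraction:
  fixes f :: "real ^ 'n \<Rightarrow> real"
  assumes M: "pos_def M"
    and smooth: "mat_smooth M f"
    and mu: "\<mu> > 0" "strongly_convex \<mu> f"
    and minimizer: "\<forall>x. f xstar \<le> f x"
    and proper: "proper_sampling D"
    and ESO: "loewner_le (hadamard (prob_mat D) M) (diag_mat (prob_vec D) ** diag_mat v)"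
    and gamma: "\<gamma> = \<alpha> - \<alpha>\<^sup>2 * Max (range (\<lambda>i. v $ i / prob_vec D $ i)) - \<sigma>"
    and gamma_nonneg: "\<gamma> \<ge> 0"
    and stepsize: "loewner_le
        ((\<gamma> * \<mu> * \<sigma>) *\<^sub>R matrix_inv (diag_mat (prob_vec D)))
        (\<sigma> *\<^sub>R mat 1 - \<alpha>\<^sup>2 *\<^sub>R (diag_mat v ** matrix_inv (diag_mat (prob_vec D)) - M))"
  shows "measure_pmf.expectation D (\<lambda>A. lyapunov f xstar D \<sigma> (sega_step f D \<alpha> s A))
     \<le> (1 - \<gamma> * \<mu>) * lyapunov f xstar D \<sigma> s"
proof -
  obtain x h where s: "s = (x, h)"
    by (cases s)
  let ?E = "measure_pmf.expectation D" and ?p = "prob_vec D"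
  let ?W = "matrix_inv (diag_mat ?p)" and ?g = "\<lambda>A. sega_g f D A x h"
  let ?m = "Max (range (\<lambda>i. v $ i / ?p $ i))"
  define u where "u = grad f x"
  define Q where "Q = (\<lambda>z :: real ^ 'n. \<Sum>i\<in>UNIV. v $ i / ?p $ i * (z $ i)\<^sup>2)"

  have descent: "f (x - \<alpha> *\<^sub>R ?g A) \<le> f x - \<alpha> * (u \<bullet> ?g A) + \<alpha>\<^sup>2/2 * wnorm2 M (?g A)" for A
  proof -
    have "f (x - \<alpha> *\<^sub>R ?g A) \<le>
        f x + u \<bullet> ((x - \<alpha> *\<^sub>R ?g A) - x) + 1/2 * wnorm2 M ((x - \<alpha> *\<^sub>R ?g A) - x)"
      using smooth unfolding mat_smooth_def u_def by blast
    also have "(x - \<alpha> *\<^sub>R ?g A) - x = (- \<alpha>) *\<^sub>R ?g A"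
      by simp
    finally show ?thesis
      by (simp only: wnorm2_scaleR_vec inner_scaleR_right) simp
  qed
  have "?E (\<lambda>A. f (x - \<alpha> *\<^sub>R ?g A))
      \<le> ?E (\<lambda>A. f x - \<alpha> * (u \<bullet> ?g A) + \<alpha>\<^sup>2/2 * wnorm2 M (?g A))"
    by (intro integral_mono descent) simp_all
  also have "\<dots> = f x - \<alpha> * (u \<bullet> u) + \<alpha>\<^sup>2/2 * ?E (\<lambda>A. wnorm2 M (?g A))"
    by (simp add: expectation_inner_sega_g[OF proper] u_def)
  also have "\<alpha>\<^sup>2/2 * ?E (\<lambda>A. wnorm2 M (?g A)) \<le> \<alpha>\<^sup>2/2 * (2 * Q u + 2 * (Q h - wnorm2 M h))"
    using expectation_wnorm2_sega_g[OF M proper ESO, of f x h]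
    by (intro mult_left_mono) (simp_all add: Q_def u_def)
  finally have f_part: "?E (\<lambda>A. f (x - \<alpha> *\<^sub>R ?g A))
      \<le> f x - \<alpha> * (u \<bullet> u) + \<alpha>\<^sup>2 * Q u + \<alpha>\<^sup>2 * (Q h - wnorm2 M h)"
    by (simp add: algebra_simps)

  have "Q u \<le> (\<Sum>i\<in>UNIV. ?m * (u $ i)\<^sup>2)"
    unfolding Q_def by (intro sum_mono mult_right_mono Max_ge) auto
  also have "\<dots> = ?m * (u \<bullet> u)"
    by (simp add: inner_vec_def sum_distrib_left power2_eq_square)
  finally have "\<alpha>\<^sup>2 * Q u \<le> \<alpha>\<^sup>2 * (?m * (u \<bullet> u))"
    by (intro mult_left_mono) simp_all
  then have gradient_part: "- \<alpha> * (u \<bullet> u) + \<alpha>\<^sup>2 * Q u + \<sigma> * (u \<bullet> u) \<le> - \<gamma> * (u \<bullet> u)"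
    unfolding gamma by (simp add: algebra_simps)

  have "\<gamma> * \<mu> * \<sigma> * wnorm2 ?W h = wnorm2 ((\<gamma> * \<mu> * \<sigma>) *\<^sub>R ?W) h"
    by (simp add: wnorm2_def scaleR_matrix_vector_assoc[symmetric])
  also have "\<dots> \<le> wnorm2 (\<sigma> *\<^sub>R mat 1 - \<alpha>\<^sup>2 *\<^sub>R (diag_mat v ** ?W - M)) h"
    by (rule loewner_leD[OF stepsize])
  also have "\<dots> = \<sigma> * (h \<bullet> h) - \<alpha>\<^sup>2 * (wnorm2 (diag_mat v ** ?W) h - wnorm2 M h)"
    by (simp add: wnorm2_def matrix_vector_mult_diff_rdistrib inner_diff_right
        scaleR_matrix_vector_assoc[symmetric])
  also have "wnorm2 (diag_mat v ** ?W) h = Q h"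
    by (simp add: matrix_inv_prob_vec[OF proper] diag_mat_mult_diag_mat wnorm2_diag_mat Q_def)
  finally have control_part:
    "\<gamma> * \<mu> * \<sigma> * wnorm2 ?W h \<le> \<sigma> * (h \<bullet> h) - \<alpha>\<^sup>2 * (Q h - wnorm2 M h)" .

  \<comment> \<open>Only half of the gradient-domination constant \<open>2 \<mu>\<close> is spent; the other half goes to the
    nonnegativity of \<open>f x - f xstar\<close>.\<close>
  have "\<mu> * (f x - f xstar) \<le> u \<bullet> u"
  proof -
    have "0 \<le> \<mu> * (f x - f xstar)"
      using mu(1) minimizer by simp
    then show ?thesis
      using strongly_convex_gradient_dominated[OF mu(2,1), of x xstar]
      by (simp only: u_def mult.assoc)
  qed
  then have "\<gamma> * (\<mu> * (f x - f xstar)) \<le> \<gamma> * (u \<bullet> u)"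
    by (intro mult_left_mono gamma_nonneg)
  then have pl: "- \<gamma> * (u \<bullet> u) \<le> - \<gamma> * \<mu> * (f x - f xstar)"
    by (simp add: mult.assoc)

  have "?E (\<lambda>A. lyapunov f xstar D \<sigma> (sega_step f D \<alpha> s A)) =
      ?E (\<lambda>A. f (x - \<alpha> *\<^sub>R ?g A)) - f xstar + \<sigma> * (wnorm2 ?W h + u \<bullet> u - h \<bullet> h)"
    by (simp add: s lyapunov_def sega_step_def u_def expectation_wnorm2_control_vector[OF proper])
  also have "\<dots> \<le> (1 - \<gamma> * \<mu>) * (f x - f xstar + \<sigma> * wnorm2 ?W h)"
    using f_part gradient_part control_part pl by (simp add: algebra_simps)
  finally show ?thesis
    by (simp add: s lyapunov_def)
qed

section \<open>Independence of the iterates and the next draw\<close>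

lemma sega_cong:
  "(\<And>j. j < k \<Longrightarrow> S j = S' j) \<Longrightarrow> sega f D \<alpha> x0 h0 S k = sega f D \<alpha> x0 h0 S' k"
  by (induction k) (simp_all add: sega_Suc del: sega.simps(2))

text \<open>The first \<open>k\<close> draws range over a finite space on which every set is measurable. So every
  function of the iterate is a measurable function of these draws, and disjoint blocks of
  independent draws are independent.\<close>

lemma
  fixes S :: "nat \<Rightarrow> 'w \<Rightarrow> 'n::finite set"
  assumes "prob_space \<Omega>"
    and indep: "prob_space.indep_vars \<Omega> (\<lambda>_. count_space UNIV) S UNIV"
  shows sega_indep_next: "prob_space.indep_var \<Omega>
      borel (\<lambda>\<omega>. g (sega f D \<alpha> x0 h0 (\<lambda>j. S j \<omega>) k) :: real) borel (\<lambda>\<omega>. q (S k \<omega>))"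
    and sega_finite_range: "finite (range (\<lambda>\<omega>. sega f D \<alpha> x0 h0 (\<lambda>j. S j \<omega>) k))"
proof -
  interpret prob_space \<Omega> by fact
  let ?PiM = "\<lambda>I. PiM I (\<lambda>_ :: nat. count_space (UNIV :: 'n set set))"
  let ?F = "\<lambda>t. sega f D \<alpha> x0 h0 t k"
  have PiM_eq: "?PiM I = count_space (PiE I (\<lambda>_. UNIV))" if "finite I" for I
    by (intro count_space_PiM_finite that) simp
  have F_restrict: "?F (restrict (\<lambda>j. S j \<omega>) {..<k}) = ?F (\<lambda>j. S j \<omega>)" for \<omega>
    by (intro sega_cong) simp
  have "indep_var (?PiM {..<k}) (\<lambda>\<omega>. restrict (\<lambda>j. S j \<omega>) {..<k})
      (?PiM {k}) (\<lambda>\<omega>. restrict (\<lambda>j. S j \<omega>) {k})"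
    by (intro indep_var_restrict[OF indep]) auto
  then have "indep_var borel ((\<lambda>t. g (?F t)) \<circ> (\<lambda>\<omega>. restrict (\<lambda>j. S j \<omega>) {..<k}))
      borel ((\<lambda>t. q (t k)) \<circ> (\<lambda>\<omega>. restrict (\<lambda>j. S j \<omega>) {k}))"
    by (rule indep_var_compose) (simp_all add: PiM_eq)
  then show "indep_var borel (\<lambda>\<omega>. g (?F (\<lambda>j. S j \<omega>))) borel (\<lambda>\<omega>. q (S k \<omega>))"
    by (simp add: comp_def F_restrict)
  have "finite (?F ` PiE {..<k} (\<lambda>_. UNIV :: 'n set set))"
    by (intro finite_imageI finite_PiE) auto
  moreover have "range (\<lambda>\<omega>. ?F (\<lambda>j. S j \<omega>)) \<subseteq> ?F ` PiE {..<k} (\<lambda>_. UNIV)"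
  proof
    fix s assume "s \<in> range (\<lambda>\<omega>. ?F (\<lambda>j. S j \<omega>))"
    then obtain \<omega> where "s = ?F (restrict (\<lambda>j. S j \<omega>) {..<k})"
      using F_restrict by auto
    then show "s \<in> ?F ` PiE {..<k} (\<lambda>_. UNIV)"
      by auto
  qed
  ultimately show "finite (range (\<lambda>\<omega>. ?F (\<lambda>j. S j \<omega>)))"
    by (rule rev_finite_subset)
qed

lemma (in prob_space) integrable_finite_range:
  fixes G :: "'b \<Rightarrow> real"
  assumes "random_variable borel (\<lambda>\<omega>. G (Z \<omega>))" "finite (range Z)"
  shows "integrable M (\<lambda>\<omega>. G (Z \<omega>))"
proof (rule integrable_const_bound[where B = "Max (range (\<lambda>\<omega>. \<bar>G (Z \<omega>)\<bar>))"])
  have "range (\<lambda>\<omega>. \<bar>G (Z \<omega>)\<bar>) = (\<lambda>s. \<bar>G s\<bar>) ` range Z"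
    by auto
  then have "finite (range (\<lambda>\<omega>. \<bar>G (Z \<omega>)\<bar>))"
    using assms(2) by simp
  then show "AE \<omega> in M. norm (G (Z \<omega>)) \<le> Max (range (\<lambda>\<omega>. \<bar>G (Z \<omega>)\<bar>))"
    by (auto intro!: Max_ge)
  show "random_variable borel (\<lambda>\<omega>. G (Z \<omega>))"
    by (rule assms(1))
qed

text \<open>Fubini for a pair of independent variables with finite range: the inner mean is taken over
  the law of the second one. It follows from splitting by the value \<open>A\<close> of \<open>X\<close> and factoring
  each \<open>E (G (Z, A) 1\<^bsub>X = A\<^esub>)\<close>. Independence is expressed through real functions of the two
  variables because \<^const>\<open>prob_space.indep_var\<close> relates only variables with values in one
  type.\<close>

lemma (in prob_space) expectation_indep_pmf:
  fixes G :: "'b \<Rightarrow> 'c::finite \<Rightarrow> real"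
  assumes indep: "\<And>g q. indep_var borel (\<lambda>\<omega>. g (Z \<omega>) :: real) borel (\<lambda>\<omega>. q (X \<omega>))"
    and X: "random_variable (count_space UNIV) X"
    and fin: "finite (range Z)"
    and law: "distr M (count_space UNIV) X = measure_pmf D"
  shows "expectation (\<lambda>\<omega>. G (Z \<omega>) (X \<omega>)) =
     expectation (\<lambda>\<omega>. measure_pmf.expectation D (G (Z \<omega>)))"
proof -
  have int_Z: "integrable M (\<lambda>\<omega>. g (Z \<omega>))" for g :: "'b \<Rightarrow> real"
    by (rule integrable_finite_range[OF indep_var_rv1[OF indep] fin])
  have int_X: "integrable M (\<lambda>\<omega>. g (X \<omega>))" for g :: "'c \<Rightarrow> real"
    by (rule integrable_finite_range[OF indep_var_rv2[OF indep]]) simp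
  have mean_X: "expectation (\<lambda>\<omega>. indicator {A} (X \<omega>) :: real) = pmf D A" for A
  proof -
    have "expectation (\<lambda>\<omega>. indicator {A} (X \<omega>) :: real) =
        integral\<^sup>L (distr M (count_space UNIV) X) (indicator {A})"
      by (rule integral_distr[symmetric, OF X]) simp
    then show ?thesis
      by (simp add: law measure_pmf_single)
  qed
  have "expectation (\<lambda>\<omega>. G (Z \<omega>) (X \<omega>)) =
      expectation (\<lambda>\<omega>. \<Sum>A\<in>UNIV. G (Z \<omega>) A * indicator {A} (X \<omega>))"
    by (intro Bochner_Integration.integral_cong) (auto simp: indicator_def)
  also have "\<dots> = (\<Sum>A\<in>UNIV. expectation (\<lambda>\<omega>. G (Z \<omega>) A * indicator {A} (X \<omega>)))"
    by (intro Bochner_Integration.integral_sum indep_var_integrable indep int_Z int_X)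
  also have "\<dots> = (\<Sum>A\<in>UNIV. expectation (\<lambda>\<omega>. G (Z \<omega>) A) * pmf D A)"
    by (simp only: indep_var_lebesgue_integral[OF indep[of "\<lambda>z. G z A" "indicator {A}" for A]
          int_Z int_X] mean_X)
  also have "\<dots> = expectation (\<lambda>\<omega>. \<Sum>A\<in>UNIV. pmf D A * G (Z \<omega>) A)"
    by (subst Bochner_Integration.integral_sum[OF int_Z]) (simp add: mult.commute)
  also have "\<dots> = expectation (\<lambda>\<omega>. measure_pmf.expectation D (G (Z \<omega>)))"
    by (simp add: integral_measure_pmf[of UNIV])
  finally show ?thesis .
qed

section \<open>Linear convergence\<close>

theorem theorem4p2:
  fixes f :: "real ^ 'n \<Rightarrow> real"
    and M :: "real ^ 'n ^ 'n"
    and v xstar x0 h0 :: "real ^ 'n"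
    and D :: "'n set pmf"
    and \<Omega> :: "'w measure"
    and S :: "nat \<Rightarrow> 'w \<Rightarrow> 'n set"
    and \<mu> \<alpha> \<sigma> \<gamma> :: real
    and k :: nat
  assumes M_pd: "pos_def M"
    and smooth: "mat_smooth M f"
    and mu_pos: "\<mu> > 0"
    and sconvex: "strongly_convex \<mu> f"
    and minimizer: "\<forall>x. f xstar \<le> f x"
    and proper: "proper_sampling D"
    and ESO: "loewner_le (hadamard (prob_mat D) M) (diag_mat (prob_vec D) ** diag_mat v)"
    and prob: "prob_space \<Omega>"
    and indep: "prob_space.indep_vars \<Omega> (\<lambda>_. count_space UNIV) S UNIV"
    and ident: "\<And>j. distr \<Omega> (count_space UNIV) (S j) = measure_pmf D"
    and alpha_pos: "\<alpha> > 0"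
    and sigma_pos: "\<sigma> > 0"
    and gamma: "\<gamma> = \<alpha> - \<alpha>\<^sup>2 * Max (range (\<lambda>i. v $ i / prob_vec D $ i)) - \<sigma>"
    and gamma_nonneg: "\<gamma> \<ge> 0"
    and stepsize: "loewner_le
        ((\<gamma> * \<mu> * \<sigma>) *\<^sub>R matrix_inv (diag_mat (prob_vec D)))
        (\<sigma> *\<^sub>R mat 1 - \<alpha>\<^sup>2 *\<^sub>R (diag_mat v ** matrix_inv (diag_mat (prob_vec D)) - M))"
  shows "prob_space.expectation \<Omega> (\<lambda>\<omega>. lyapunov f xstar D \<sigma> (sega f D \<alpha> x0 h0 (\<lambda>j. S j \<omega>) k))
         \<le> (1 - \<gamma> * \<mu>) ^ k * lyapunov f xstar D \<sigma> (x0, h0)"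
proof -
  interpret prob_space \<Omega> by fact
  let ?\<Psi> = "lyapunov f xstar D \<sigma>"
  let ?Z = "\<lambda>k \<omega>. sega f D \<alpha> x0 h0 (\<lambda>j. S j \<omega>) k"
  note contraction = sega_lyapunov_contraction[OF M_pd smooth mu_pos sconvex minimizer proper ESO
      gamma gamma_nonneg stepsize]
  note nonneg = lyapunov_nonneg[OF proper less_imp_le[OF sigma_pos] minimizer]

  have factor_nonneg: "0 \<le> 1 - \<gamma> * \<mu>"
  proof -
    let ?s = "(xstar, axis undefined 1 :: real ^ 'n)"
    have "0 < (\<Sum>i\<in>UNIV. 1 / prob_vec D $ i * ((axis undefined 1 :: real ^ 'n) $ i)\<^sup>2)"
      using proper by (intro sum_pos2[of _ undefined])
        (auto simp: proper_sampling_def less_imp_le axis_def)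
    then have pos: "0 < ?\<Psi> ?s"
      using sigma_pos by (simp add: lyapunov_def matrix_inv_prob_vec[OF proper] wnorm2_diag_mat)
    have "0 \<le> measure_pmf.expectation D (\<lambda>A. ?\<Psi> (sega_step f D \<alpha> ?s A))"
      by (intro Bochner_Integration.integral_nonneg nonneg)
    also have "\<dots> \<le> (1 - \<gamma> * \<mu>) * ?\<Psi> ?s"
      by (rule contraction)
    finally show ?thesis
      using pos by (simp add: zero_le_mult_iff)
  qed

  show ?thesis
  proof (induction k)
    case 0
    show ?case
      by (simp add: prob_space)
  next
    case (Suc k)
    note indep_next = sega_indep_next[OF prob indep, where f = f and D = D and \<alpha> = \<alpha> and ?x0.0 = x0 and ?h0.0 = h0 and k = k]
      and fin = sega_finite_range[OF prob indep, where f = f and D = D and \<alpha> = \<alpha> and ?x0.0 = x0 and ?h0.0 = h0 and k = k]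
    have draw: "random_variable (count_space UNIV) (S k)"
      using indep by (simp add: indep_vars_def)
    have "expectation (\<lambda>\<omega>. ?\<Psi> (?Z (Suc k) \<omega>)) =
        expectation (\<lambda>\<omega>. ?\<Psi> (sega_step f D \<alpha> (?Z k \<omega>) (S k \<omega>)))"
      by (simp only: sega_Suc)
    also have "\<dots> = expectation (\<lambda>\<omega>. measure_pmf.expectation D
        (\<lambda>A. ?\<Psi> (sega_step f D \<alpha> (?Z k \<omega>) A)))"
      by (rule expectation_indep_pmf[OF indep_next draw fin ident])
    also have "\<dots> \<le> expectation (\<lambda>\<omega>. (1 - \<gamma> * \<mu>) * ?\<Psi> (?Z k \<omega>))"
      by (intro integral_mono contraction integrable_finite_range[OF indep_var_rv1[OF indep_next] fin])
    also have "\<dots> = (1 - \<gamma> * \<mu>) * expectation (\<lambda>\<omega>. ?\<Psi> (?Z k \<omega>))"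
      by simp
    also have "\<dots> \<le> (1 - \<gamma> * \<mu>) * ((1 - \<gamma> * \<mu>) ^ k * ?\<Psi> (x0, h0))"
      by (intro mult_left_mono Suc.IH factor_nonneg)
    finally show ?case
      by (simp add: mult.assoc)
  qed
qed

end
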